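(* Let $G$ be any graph with $n$ vertices, and let $H$ be a symmetric $d\times d$ complex Hadamard matrix all of whose first-row and first-column entries equal $1$. For any $S$-symmetry $(P,D)$ of $H$ and any $a\in V(G)$, the generalized graph state $|\psi_{G,H}\rangle$ is stabilized by $P_a\prod_{ab\in E(G)}D_b$, i.e. $$P_a\prod_{ab\in E(G)}D_b\,|\psi_{G,H}\rangle=|\psi_{G,H}\rangle ,$$ where the product runs over the neighbours $b$ of $a$ in $G$, and $P_a$, $D_b$ denote $P$ acting on qudit $a$ and $D$ acting on qudit $b$, respectively.
   Context: A complex Hadamard matrix of size $d$ is a $d\times d$ complex matrix $H=(h_{ij})_{i,j=0}^{d-1}$ with $|h_{ij}|=1$ for all $i,j$ and $H^\dagger H=dI_d$; it is symmetric if $H=H^T$. For a symmetric Hadamard matrix $H$, a pair $(P,D)$ consisting of a $d\times d$ permutation matrix $P$ and a $d\times d$ diagonal unitary matrix $D$ is called an $S$-symmetry of $H$ if $PHD=H$. A qudit has state space $\mathbb{C}^d$ with computational basis $|0\rangle,\dots,|d-1\rangle$. For symmetric $H$, the generalized controlled-$Z$ gate $C^H$ is the diagonal operator on $\mathbb{C}^d\otimes\mathbb{C}^d$ with $C^H|ij\rangle=h_{ij}|ij\rangle$; $C^H_{ab}$ denotes this gate acting on qudits $a,b$ of an $n$-qudit system. For a (finite, simple) undirected graph $G$ with vertex set $V(G)=\{1,\dots,n\}$ and edge set $E(G)$, the generalized graph state in $(\mathbb{C}^d)^{\otimes n}$ is $$|\psi_{G,H}\rangle=\mathcal{U}_{G,H}|0\rangle^{\otimes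 n},\qquad \mathcal{U}_{G,H}=\frac{1}{d^{n/2}}\Big(\prod_{ab\in E(G)}C^H_{ab}\Big)H^{\otimes n}.$$ *)

theory Defs
  imports
    "Jordan_Normal_Form.Schur_Decomposition"
    "Graph_Theory.Pair_Digraph"
    "HOL-Combinatorics.Permutations"
    Complex_Main
begin

section \<open>Hadamard matrices and their S-symmetries\<close>

definition hadamard_mat :: "nat \<Rightarrow> complex mat \<Rightarrow> bool" where
  "hadamard_mat d H \<longleftrightarrow> H \<in> carrier_mat d d \<and>
     (\<forall>i<d. \<forall>j<d. cmod (H $$ (i, j)) = 1) \<and>
     mat_adjoint H * H = of_nat d \<cdot>\<^sub>m 1\<^sub>m d"

definition symmetric_hadamard_mat :: "nat \<Rightarrow> complex mat \<Rightarrow> bool" where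
  "symmetric_hadamard_mat d H \<longleftrightarrow> hadamard_mat d H \<and> transpose_mat H = H"

definition permutation_mat :: "nat \<Rightarrow> complex mat \<Rightarrow> bool" where
  "permutation_mat d P \<longleftrightarrow>
     (\<exists>\<pi>. \<pi> permutes {..<d} \<and> P = mat d d (\<lambda>(i, j). if i = \<pi> j then 1 else 0))"

definition diagonal_unitary_mat :: "nat \<Rightarrow> complex mat \<Rightarrow> bool" where
  "diagonal_unitary_mat d D \<longleftrightarrow>
     D \<in> carrier_mat d d \<and> diagonal_mat D \<and> mat_adjoint D * D = 1\<^sub>m d"

definition S_symmetry :: "nat \<Rightarrow> complex mat \<Rightarrow> complex mat \<Rightarrow> complex mat \<Rightarrow> bool" where
  "S_symmetry d H P D \<longleftrightarrow> permutation_mat d P \<and> diagonal_unitary_mat d D \<and> P * H * D = H"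


section \<open>Systems of qudits\<close>

text \<open>
  The \<open>n\<close>-fold tensor power of \<open>\<complex>\<^sup>d\<close> is \<open>\<complex>\<close> to the power \<open>d ^ n\<close>, with the usual
  (Kronecker) ordering of the computational basis: the basis vector of the qudit values
  \<open>x\<^sub>1, \<dots>, x\<^sub>n\<close> has as its index the number with the base \<open>d\<close> digits \<open>x\<^sub>1 \<dots> x\<^sub>n\<close>, where \<open>x\<^sub>1\<close> is
  the most significant one. So \<open>qudit_val d n x i\<close> is the value of qudit \<open>i\<close>, for \<open>1 \<le> i \<le> n\<close>,
  in the basis vector with index \<open>x < d ^ n\<close>.
\<close>

definition qudit_val :: "nat \<Rightarrow> nat \<Rightarrow> nat \<Rightarrow> nat \<Rightarrow> nat" where
  "qudit_val d n x i = x div d ^ (n - i) mod d"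

definition tensor_power_vec :: "nat \<Rightarrow> nat \<Rightarrow> complex vec \<Rightarrow> complex vec" where
  "tensor_power_vec d n v = vec (d ^ n) (\<lambda>x. \<Prod>i\<in>{1..n}. v $ qudit_val d n x i)"

definition tensor_power_mat :: "nat \<Rightarrow> nat \<Rightarrow> complex mat \<Rightarrow> complex mat" where
  "tensor_power_mat d n A = mat (d ^ n) (d ^ n)
     (\<lambda>(x, y). \<Prod>i\<in>{1..n}. A $$ (qudit_val d n x i, qudit_val d n y i))"

text \<open>
  The extension by the identity, to \<open>n\<close> qudits, of an operator on one qudit and of an operator
  on two qudits. The latter operator is a matrix of size \<open>d * d\<close>, in which \<open>|ij\<rangle>\<close> has index \<open>i * d + j\<close>.
\<close>

definition on_qudit :: "nat \<Rightarrow> nat \<Rightarrow> complex mat \<Rightarrow> nat \<Rightarrow> complex mat" where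
  "on_qudit d n A a = mat (d ^ n) (d ^ n)
     (\<lambda>(x, y). if \<forall>i\<in>{1..n} - {a}. qudit_val d n x i = qudit_val d n y i
               then A $$ (qudit_val d n x a, qudit_val d n y a) else 0)"

definition on_two_qudits :: "nat \<Rightarrow> nat \<Rightarrow> complex mat \<Rightarrow> nat \<Rightarrow> nat \<Rightarrow> complex mat" where
  "on_two_qudits d n A a b = mat (d ^ n) (d ^ n)
     (\<lambda>(x, y). if \<forall>i\<in>{1..n} - {a, b}. qudit_val d n x i = qudit_val d n y i
               then A $$ (qudit_val d n x a * d + qudit_val d n x b,
                          qudit_val d n y a * d + qudit_val d n y b) else 0)"

definition controlled_Z :: "nat \<Rightarrow> complex mat \<Rightarrow> complex mat" where
  "controlled_Z d H = mat (d * d) (d * d) (\<lambda>(k, l). if k = l then H $$ (k div d, k mod d) else 0)"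

definition mat_prod_list :: "nat \<Rightarrow> complex mat list \<Rightarrow> complex mat" where
  "mat_prod_list N As = foldr (*) As (1\<^sub>m N)"


section \<open>Generalized graph states\<close>

text \<open>
  A finite simple undirected graph is a finite loop-free symmetric digraph, so each edge is
  present as two arcs; the product over the edges selects the arc \<open>(a, b)\<close> with \<open>a < b\<close>. Neither this
  choice nor the order of the factors matters: \<open>H\<close> is symmetric and all factors are diagonal.
\<close>

definition edge_product :: "nat \<Rightarrow> nat \<Rightarrow> nat pair_pre_digraph \<Rightarrow> complex mat \<Rightarrow> complex mat" where
  "edge_product d n G H = mat_prod_list (d ^ n)
     [on_two_qudits d n (controlled_Z d H) a b.
        a \<leftarrow> [1..<n + 1], b \<leftarrow> [1..<n + 1], a < b \<and> (a, b) \<in> parcs G]"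

definition neighbour_product ::
  "nat \<Rightarrow> nat \<Rightarrow> nat pair_pre_digraph \<Rightarrow> complex mat \<Rightarrow> nat \<Rightarrow> complex mat" where
  "neighbour_product d n G D a = mat_prod_list (d ^ n)
     [on_qudit d n D b. b \<leftarrow> [1..<n + 1], (a, b) \<in> parcs G]"

definition graph_state_op :: "nat \<Rightarrow> nat \<Rightarrow> nat pair_pre_digraph \<Rightarrow> complex mat \<Rightarrow> complex mat" where
  "graph_state_op d n G H = complex_of_real (1 / real d powr (real n / 2)) \<cdot>\<^sub>m
     (edge_product d n G H * tensor_power_mat d n H)"

definition graph_state :: "nat \<Rightarrow> nat \<Rightarrow> nat pair_pre_digraph \<Rightarrow> complex mat \<Rightarrow> complex vec" where
  "graph_state d n G H = graph_state_op d n G H *\<^sub>v tensor_power_vec d n (unit_vec d 0)"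

end

theory Submission
  imports Defs
begin

text \<open>
  On the state \<open>H\<^sup>\<otimes>\<^sup>n |0\<dots>0\<rangle>\<close> all amplitudes are 1, since the first column of \<open>H\<close> is constant.
  Hence the amplitude of the graph state at \<open>x\<close> is, up to normalization, the product of
  \<open>H (x\<^sub>i, x\<^sub>j)\<close> over the edges \<open>ij\<close>. If \<open>P\<close> is given by the permutation \<open>\<pi>\<close>, then \<open>P H D = H\<close>
  says \<open>H (k, l) * D (l, l) = H (\<pi> k, l)\<close>. So multiplying by \<open>D\<close> on each neighbour of \<open>a\<close> has the same
  effect on the amplitudes as replacing \<open>x\<^sub>a\<close> by \<open>\<pi> x\<^sub>a\<close>, which is what \<open>P\<close> on \<open>a\<close> undoes.
\<close>

section \<open>Basis indices and their base \<open>d\<close> digits\<close>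

lemma digits_inject:
  fixes d :: nat
  assumes "x < d ^ n" "y < d ^ n" "\<And>k. k < n \<Longrightarrow> x div d ^ k mod d = y div d ^ k mod d"
  shows "x = y"
  using assms
proof (induction n arbitrary: x y)
  case (Suc n)
  \<comment> \<open>Split off the least significant digit: the digits of \<open>x div d\<close> are
    those of \<open>x\<close> shifted by one place, and the missing digit is
    \<open>x mod d\<close>.\<close>
  have "x div d = y div d"
  proof (rule Suc.IH)
    show "x div d < d ^ n" "y div d < d ^ n"
      using Suc.prems by (simp_all add: less_mult_imp_div_less mult.commute)
    show "x div d div d ^ k mod d = y div d div d ^ k mod d" if "k < n" for k
      using Suc.prems(3)[of "Suc k"] that by (simp add: div_mult2_eq)
  qed
  moreover have "x mod d = y mod d"
    using Suc.prems(3)[of 0] by simp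
  ultimately show ?case
    by (metis div_mult_mod_eq)
qed simp

lemma qudit_val_less: "0 < d \<Longrightarrow> qudit_val d n x i < d"
  by (simp add: qudit_val_def)

lemma qudit_val_inject:
  assumes "x < d ^ n" "y < d ^ n" "\<And>i. i \<in> {1..n} \<Longrightarrow> qudit_val d n x i = qudit_val d n y i"
  shows "x = y"
proof (rule digits_inject[OF assms(1,2)])
  show "x div d ^ k mod d = y div d ^ k mod d" if "k < n" for k
    \<comment> \<open>The digit of weight \<open>d ^ k\<close> belongs to qudit
      \<open>n - k\<close>, which lies in \<open>{1..n}\<close> exactly because
      \<open>k < n\<close>.\<close>
    using assms(3)[of "n - k"] that by (simp add: qudit_val_def)
qed

text \<open>Counting: reading off digits is injective, and there are \<open>d ^ n\<close> indices
  and equally many assignments of values to the qudits. This is what allows the value of a single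
  qudit to be changed later on.\<close>

lemma qudit_val_surj:
  assumes "0 < d" "\<And>i. i \<in> {1..n} \<Longrightarrow> f i < d"
  obtains x where "x < d ^ n" "\<And>i. i \<in> {1..n} \<Longrightarrow> qudit_val d n x i = f i"
proof -
  \<comment> \<open>The restriction puts the digit functions into the finite set of extensional
    functions, whose cardinality is known.\<close>
  let ?v = "\<lambda>x. restrict (qudit_val d n x) {1..n}"
  have "inj_on ?v {..<d ^ n}"
  proof (rule inj_onI)
    fix x y assume "x \<in> {..<d ^ n}" "y \<in> {..<d ^ n}" and eq: "?v x = ?v y"
    moreover have "qudit_val d n x i = qudit_val d n y i" if "i \<in> {1..n}" for i
      using fun_cong[OF eq, of i] that by simp
    ultimately show "x = y"
      using qudit_val_inject by blast
  qed
  then have "card (?v ` {..<d ^ n}) = card ({1..n} \<rightarrow>\<^sub>E {..<d})"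
    by (simp add: card_image card_PiE)
  moreover have "?v ` {..<d ^ n} \<subseteq> {1..n} \<rightarrow>\<^sub>E {..<d}"
    using qudit_val_less[OF assms(1)] by auto
  ultimately have "?v ` {..<d ^ n} = {1..n} \<rightarrow>\<^sub>E {..<d}"
    by (intro card_subset_eq finite_PiE) auto
  moreover have "restrict f {1..n} \<in> {1..n} \<rightarrow>\<^sub>E {..<d}"
    using assms(2) by auto
  ultimately have "restrict f {1..n} \<in> ?v ` {..<d ^ n}"
    by (simp only:)
  then obtain x where x: "x < d ^ n" "restrict f {1..n} = ?v x"
    by (elim imageE) simp
  have "qudit_val d n x i = f i" if "i \<in> {1..n}" for i
    using fun_cong[OF x(2), of i] that by simp
  with x(1) show ?thesis
    using that by blast
qed

section \<open>Diagonal matrices, given by functions of the basis index\<close>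

definition diag_of :: "nat \<Rightarrow> (nat \<Rightarrow> 'a::zero) \<Rightarrow> 'a mat" where
  "diag_of N g = mat N N (\<lambda>(x, y). if x = y then g x else 0)"

lemma diag_of_dim [simp]: "dim_row (diag_of N g) = N" "dim_col (diag_of N g) = N"
  by (simp_all add: diag_of_def)

lemma diag_of_mult:
  fixes A :: "'a::semiring_0 mat"
  assumes "dim_row A = N"
  shows "diag_of N g * A = mat N (dim_col A) (\<lambda>(x, y). g x * A $$ (x, y))"
proof (rule eq_matI)
  fix x y assume "x < dim_row (mat N (dim_col A) (\<lambda>(x, y). g x * A $$ (x, y)))"
    and "y < dim_col (mat N (dim_col A) (\<lambda>(x, y). g x * A $$ (x, y)))"
  then have "x < N" "y < dim_col A" by simp_all
  then have "(diag_of N g * A) $$ (x, y) = (\<Sum>k\<in>{0..<N}. (if x = k then g x else 0) * A $$ (k, y))"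
    using assms by (simp add: diag_of_def scalar_prod_def)
  also have "\<dots> = (\<Sum>k\<in>{0..<N}. if k = x then g x * A $$ (x, y) else 0)"
    by (intro sum.cong) auto
  finally have "(diag_of N g * A) $$ (x, y)
      = (\<Sum>k\<in>{0..<N}. if k = x then g x * A $$ (x, y) else 0)" .
  with \<open>x < N\<close> \<open>y < dim_col A\<close>
  show "(diag_of N g * A) $$ (x, y) = mat N (dim_col A) (\<lambda>(x, y). g x * A $$ (x, y)) $$ (x, y)"
    by simp
qed (use assms in simp_all)

lemma diag_of_mult_vec:
  fixes v :: "'a::semiring_0 vec"
  assumes "dim_vec v = N"
  shows "diag_of N g *\<^sub>v v = vec N (\<lambda>x. g x * v $ x)"
proof (rule eq_vecI)
  fix x assume "x < dim_vec (vec N (\<lambda>x. g x * v $ x))"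
  then have x: "x < N" by simp
  then have "(diag_of N g *\<^sub>v v) $ x = (\<Sum>k\<in>{0..<N}. (if x = k then g x else 0) * v $ k)"
    using assms by (simp add: diag_of_def scalar_prod_def)
  also have "\<dots> = (\<Sum>k\<in>{0..<N}. if k = x then g x * v $ x else 0)"
    by (intro sum.cong) auto
  finally have "(diag_of N g *\<^sub>v v) $ x = (\<Sum>k\<in>{0..<N}. if k = x then g x * v $ x else 0)" .
  with x show "(diag_of N g *\<^sub>v v) $ x = vec N (\<lambda>x. g x * v $ x) $ x"
    by simp
qed simp

lemma mat_prod_list_diag_of:
  assumes "\<And>k. k \<in> set ks \<Longrightarrow> A k = diag_of N (g k)"
  shows "mat_prod_list N (map A ks) = diag_of N (\<lambda>x. \<Prod>k\<leftarrow>ks. g k x)"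
  using assms
proof (induction ks)
  case Nil
  show ?case by (auto simp: mat_prod_list_def diag_of_def)
next
  case (Cons k ks)
  then have "mat_prod_list N (map A (k # ks)) = diag_of N (g k) * diag_of N (\<lambda>x. \<Prod>k\<leftarrow>ks. g k x)"
    by (simp add: mat_prod_list_def)
  also have "\<dots> = diag_of N (\<lambda>x. \<Prod>k\<leftarrow>k # ks. g k x)"
    by (subst diag_of_mult) (auto simp: diag_of_def)
  finally show ?case .
qed

text \<open>Holds for every \<open>d\<close>, so it also serves the degenerate case
  \<open>d = 0\<close>, to which the diagonal form below does not apply.\<close>

lemma edge_product_dim_row: "dim_row (edge_product d n G H) = d ^ n"
proof -
  have dim: "dim_row (mat_prod_list N As) = N" if "\<forall>A\<in>set As. dim_row A = N" for N As
    using that by (cases As) (simp_all add: mat_prod_list_def)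
  show ?thesis
    unfolding edge_product_def
    by (rule dim) (auto simp: on_two_qudits_def simp del: upt_Suc)
qed

section \<open>Diagonal form of the gates and of their products\<close>

text \<open>Two distinct indices that agree away from \<open>b\<close> must differ at
  \<open>b\<close>, so the entry is an off-diagonal one of \<open>D\<close> and vanishes.\<close>

lemma on_qudit_diag:
  assumes "0 < d" "D \<in> carrier_mat d d" "diagonal_mat D" "b \<in> {1..n}"
  shows "on_qudit d n D b
    = diag_of (d ^ n) (\<lambda>x. D $$ (qudit_val d n x b, qudit_val d n x b))"
proof -
  have "D $$ (qudit_val d n x b, qudit_val d n y b) = 0"
    if "x < d ^ n" "y < d ^ n" "x \<noteq> y" "\<forall>i\<in>{1..n} - {b}. qudit_val d n x i = qudit_val d n y i"
    for x y
  proof -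
    have "qudit_val d n x b \<noteq> qudit_val d n y b"
      using that qudit_val_inject[of x d n y] by blast
    then show ?thesis
      using assms(2,3) qudit_val_less[OF assms(1)] by (auto simp: diagonal_mat_def)
  qed
  then show ?thesis
    unfolding on_qudit_def diag_of_def by (intro cong_mat) auto
qed

lemma on_two_qudits_controlled_Z:
  assumes "0 < d" "a \<in> {1..n}" "b \<in> {1..n}"
  shows "on_two_qudits d n (controlled_Z d H) a b
    = diag_of (d ^ n) (\<lambda>x. H $$ (qudit_val d n x a, qudit_val d n x b))"
proof -
  have less: "i * d + j < d * d" if "i < d" "j < d" for i j
  proof -
    have "i * d + j < Suc i * d" using that by simp
    also have "\<dots> \<le> d * d" using that by (intro mult_le_mono1) simp
    finally show ?thesis .
  qed
  have cZ: "controlled_Z d H $$ (i * d + j, k * d + l) = (if i = k \<and> j = l then H $$ (i, j) else 0)"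
    if "i < d" "j < d" "k < d" "l < d" for i j k l
  proof -
    \<comment> \<open>Uniqueness of quotient and remainder on division by \<open>d\<close>.\<close>
    have "i * d + j = k * d + l \<longleftrightarrow> i = k \<and> j = l"
      using that by (metis div_mult_self3 add.right_neutral add.commute div_less mod_mult_self3
          mod_less less_nat_zero_code)
    then show ?thesis
      using that less by (simp add: controlled_Z_def)
  qed
  have "x = y" if "x < d ^ n" "y < d ^ n" "\<forall>i\<in>{1..n} - {a, b}. qudit_val d n x i = qudit_val d n y i"
    "qudit_val d n x a = qudit_val d n y a" "qudit_val d n x b = qudit_val d n y b" for x y
    using that by (intro qudit_val_inject[of x d n y]) auto
  then show ?thesis
    unfolding on_two_qudits_def diag_of_def
    by (intro cong_mat) (auto simp: cZ qudit_val_less assms(1))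
qed

lemma concat_map_if_singleton:
  "concat (map (\<lambda>x. if Q x then [f x] else []) xs) = map f (filter Q xs)"
  by (induction xs) auto

text \<open>The nested comprehension is a filtered list of pairs without repetitions, so its product
  may be taken over the set of edges instead; this removes the order of the factors.\<close>

lemma edge_product_diag:
  assumes "0 < d"
  shows "edge_product d n G H = diag_of (d ^ n)
    (\<lambda>x. \<Prod>(i, j)\<in>{(i, j). i \<in> {1..n} \<and> j \<in> {1..n} \<and> i < j \<and> (i, j) \<in> parcs G}.
      H $$ (qudit_val d n x i, qudit_val d n x j))"
proof -
  let ?Q = "\<lambda>(i, j). i < j \<and> (i, j) \<in> parcs G"
  let ?L = "filter ?Q (List.product [1..<n + 1] [1..<n + 1])"
  let ?A = "\<lambda>(i, j). on_two_qudits d n (controlled_Z d H) i j"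
  have "edge_product d n G H = mat_prod_list (d ^ n) (map ?A ?L)"
    unfolding edge_product_def product_concat_map filter_concat map_concat
    by (simp add: concat_map_if_singleton filter_map comp_def del: upt_Suc)
  also have "\<dots> = diag_of (d ^ n)
      (\<lambda>x. \<Prod>p\<leftarrow>?L. (case p of (i, j) \<Rightarrow> H $$ (qudit_val d n x i, qudit_val d n x j)))"
    by (rule mat_prod_list_diag_of)
       (auto intro!: on_two_qudits_controlled_Z[OF assms] simp del: upt_Suc)
  also have "\<dots> = diag_of (d ^ n) (\<lambda>x. \<Prod>p\<in>set ?L. (case p of (i, j) \<Rightarrow>
      H $$ (qudit_val d n x i, qudit_val d n x j)))"
    by (subst prod.distinct_set_conv_list) (simp_all add: distinct_product del: upt_Suc)
  also have "set ?L = {(i, j). i \<in> {1..n} \<and> j \<in> {1..n} \<and> i < j \<and> (i, j) \<in> parcs G}"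
    by auto
  finally show ?thesis .
qed

lemma neighbour_product_diag:
  assumes "0 < d" "D \<in> carrier_mat d d" "diagonal_mat D"
  shows "neighbour_product d n G D a = diag_of (d ^ n)
    (\<lambda>x. \<Prod>b\<in>{b \<in> {1..n}. (a, b) \<in> parcs G}. D $$ (qudit_val d n x b, qudit_val d n x b))"
proof -
  let ?L = "filter (\<lambda>b. (a, b) \<in> parcs G) [1..<n + 1]"
  have "neighbour_product d n G D a = mat_prod_list (d ^ n) (map (on_qudit d n D) ?L)"
    unfolding neighbour_product_def by (simp add: concat_map_if_singleton del: upt_Suc)
  also have "\<dots> = diag_of (d ^ n)
      (\<lambda>x. \<Prod>b\<leftarrow>?L. D $$ (qudit_val d n x b, qudit_val d n x b))"
    by (rule mat_prod_list_diag_of) (auto intro!: on_qudit_diag[OF assms] simp del: upt_Suc)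
  also have "\<dots> = diag_of (d ^ n)
      (\<lambda>x. \<Prod>b\<in>set ?L. D $$ (qudit_val d n x b, qudit_val d n x b))"
    by (subst prod.distinct_set_conv_list) (simp_all del: upt_Suc)
  also have "set ?L = {b \<in> {1..n}. (a, b) \<in> parcs G}"
    by auto
  finally show ?thesis .
qed

section \<open>Amplitudes of the graph state\<close>

text \<open>The zero state is the basis vector of index 0, so it selects the column of index 0,
  whose entries are products of entries \<open>H $$ (i, 0)\<close>.\<close>

lemma tensor_power_mat_mult_zero_state:
  assumes "0 < d" "\<forall>i<d. H $$ (i, 0) = 1"
  shows "tensor_power_mat d n H *\<^sub>v tensor_power_vec d n (unit_vec d 0) = vec (d ^ n) (\<lambda>_. 1)"
proof (rule eq_vecI)
  fix x assume "x < dim_vec (vec (d ^ n) (\<lambda>_. 1::complex))"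
  then have x: "x < d ^ n" by simp
  have zero: "(\<Prod>i\<in>{1..n}. unit_vec d 0 $ qudit_val d n y i) = (if y = 0 then 1 else (0::complex))"
    if y: "y < d ^ n" for y
  proof (cases "y = 0")
    case True
    then show ?thesis using assms(1) by (simp add: qudit_val_def)
  next
    case False
    \<comment> \<open>All digits of the index 0 are 0, so by injectivity a nonzero \<open>y\<close>
      has a nonzero digit; that digit makes one factor vanish.\<close>
    then obtain i where "i \<in> {1..n}" "qudit_val d n y i \<noteq> 0"
      using qudit_val_inject[of y d n 0] y assms(1) by (force simp: qudit_val_def)
    then show ?thesis
      using False qudit_val_less[OF assms(1)] by (auto simp: assms(1) intro!: bexI[of _ i])
  qed
  have "(tensor_power_mat d n H *\<^sub>v tensor_power_vec d n (unit_vec d 0)) $ x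
      = (\<Sum>y\<in>{0..<d ^ n}. (\<Prod>i\<in>{1..n}. H $$ (qudit_val d n x i, qudit_val d n y i)) *
          (\<Prod>i\<in>{1..n}. unit_vec d 0 $ qudit_val d n y i))"
    using x by (simp add: tensor_power_mat_def tensor_power_vec_def scalar_prod_def)
  also have "\<dots> = (\<Sum>y\<in>{0..<d ^ n}. (\<Prod>i\<in>{1..n}. H $$ (qudit_val d n x i, qudit_val d n y i)) *
      (if y = 0 then 1 else 0))"
    by (intro sum.cong refl arg_cong2[where f = "(*)"] zero) simp
  also have "\<dots> = (\<Sum>y\<in>{0..<d ^ n}. if y = 0 then 1 else 0)"
    using assms qudit_val_less[OF assms(1)]
    by (intro sum.cong) (auto simp: qudit_val_def[of d n 0])
  finally show "(tensor_power_mat d n H *\<^sub>v tensor_power_vec d n (unit_vec d 0)) $ x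
      = vec (d ^ n) (\<lambda>_. 1) $ x"
    using x assms(1) by simp
qed (simp add: tensor_power_mat_def)

lemma smult_mat_mult_vec:
  fixes A :: "'a::comm_semiring_0 mat"
  assumes "A \<in> carrier_mat m k" "v \<in> carrier_vec k"
  shows "(c \<cdot>\<^sub>m A) *\<^sub>v v = c \<cdot>\<^sub>v (A *\<^sub>v v)"
  using assms by (intro eq_vecI) (auto simp: scalar_prod_def sum_distrib_left mult.assoc)

lemma graph_state_amplitude:
  assumes "0 < d" "\<forall>i<d. H $$ (i, 0) = 1"
  shows "graph_state d n G H = vec (d ^ n) (\<lambda>x. complex_of_real (1 / real d powr (real n / 2)) *
    (\<Prod>(i, j)\<in>{(i, j). i \<in> {1..n} \<and> j \<in> {1..n} \<and> i < j \<and> (i, j) \<in> parcs G}.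
      H $$ (qudit_val d n x i, qudit_val d n x j)))"
proof -
  have E: "edge_product d n G H \<in> carrier_mat (d ^ n) (d ^ n)"
    by (simp add: edge_product_diag[OF assms(1)] diag_of_def)
  have T: "tensor_power_mat d n H \<in> carrier_mat (d ^ n) (d ^ n)"
    by (simp add: tensor_power_mat_def)
  have v: "tensor_power_vec d n (unit_vec d 0) \<in> carrier_vec (d ^ n)"
    by (simp add: tensor_power_vec_def)
  have "graph_state d n G H = complex_of_real (1 / real d powr (real n / 2)) \<cdot>\<^sub>v
      (edge_product d n G H *\<^sub>v (tensor_power_mat d n H *\<^sub>v tensor_power_vec d n (unit_vec d 0)))"
    unfolding graph_state_def graph_state_op_def
    using E T v by (simp add: smult_mat_mult_vec[of _ "d ^ n" "d ^ n"]
        assoc_mult_mat_vec[of _ "d ^ n" "d ^ n" _ "d ^ n"])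
  then show ?thesis
    unfolding tensor_power_mat_mult_zero_state[OF assms] edge_product_diag[OF assms(1)]
    by (subst (asm) diag_of_mult_vec) (auto intro!: eq_vecI)
qed

section \<open>Action of an S-symmetry on entries\<close>

text \<open>Row \<open>x\<close> has its only nonzero entry in column \<open>y\<close>: a column
  \<open>z\<close> contributes only if it agrees with \<open>x\<close> away from \<open>a\<close>
  and \<open>\<pi>\<close> sends its value at \<open>a\<close> to that of \<open>x\<close>, and
  \<pi> is injective.\<close>

lemma on_qudit_permutation_mult_vec:
  assumes "0 < d" "\<pi> permutes {..<d}" "P = mat d d (\<lambda>(i, j). if i = \<pi> j then 1 else 0)"
    and "a \<in> {1..n}" "v \<in> carrier_vec (d ^ n)" "y < d ^ n" "x < d ^ n"
    and "qudit_val d n x a = \<pi> (qudit_val d n y a)"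
    and "\<And>i. i \<in> {1..n} - {a} \<Longrightarrow> qudit_val d n x i = qudit_val d n y i"
  shows "(on_qudit d n P a *\<^sub>v v) $ x = v $ y"
proof -
  have "z = y" if "z < d ^ n" "\<forall>i\<in>{1..n} - {a}. qudit_val d n x i = qudit_val d n z i"
    "qudit_val d n x a = \<pi> (qudit_val d n z a)" for z
  proof (rule qudit_val_inject[OF that(1) assms(6)])
    fix i assume "i \<in> {1..n}"
    have "qudit_val d n z a = qudit_val d n y a"
      using that(3) assms(8) permutes_inj[OF assms(2)] by (simp add: inj_eq)
    with \<open>i \<in> {1..n}\<close> that(2) assms(9) show "qudit_val d n z i = qudit_val d n y i"
      by (cases "i = a") auto
  qed
  moreover have "P $$ (qudit_val d n x a, qudit_val d n z a)
      = (if qudit_val d n x a = \<pi> (qudit_val d n z a) then 1 else 0)" for z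
    using assms(3) qudit_val_less[OF assms(1)] by simp
  ultimately have entry: "on_qudit d n P a $$ (x, z) = (if z = y then 1 else 0)" if "z < d ^ n" for z
    using that assms(7-9) by (auto simp: on_qudit_def)
  have "(on_qudit d n P a *\<^sub>v v) $ x = (\<Sum>z\<in>{0..<d ^ n}. on_qudit d n P a $$ (x, z) * v $ z)"
    using assms(5,7) by (simp add: on_qudit_def scalar_prod_def)
  also have "\<dots> = (\<Sum>z\<in>{0..<d ^ n}. if z = y then v $ y else 0)"
    by (intro sum.cong) (auto simp: entry)
  finally show ?thesis
    using assms(6) by simp
qed

text \<open>Row \<open>\<pi> k\<close> of \<open>P * H\<close> is row \<open>k\<close> of
  \<open>H\<close>, and multiplication by \<open>D\<close> on the right scales column
  \<open>l\<close> by \<open>D $$ (l, l)\<close>.\<close>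

lemma S_symmetry_entries:
  fixes H :: "'a::semiring_1 mat"
  assumes "H \<in> carrier_mat d d" "D \<in> carrier_mat d d" "diagonal_mat D"
    and "\<pi> permutes {..<d}" "P = mat d d (\<lambda>(i, j). if i = \<pi> j then 1 else 0)" "P * H * D = H"
    and "k < d" "l < d"
  shows "H $$ (\<pi> k, l) = H $$ (k, l) * D $$ (l, l)"
proof -
  have \<pi>k: "\<pi> k < d"
    using permutes_in_image[OF assms(4), of k] assms(7) by simp
  have PH: "(P * H) $$ (\<pi> k, m) = H $$ (k, m)" if "m < d" for m
  proof -
    have "(P * H) $$ (\<pi> k, m) = (\<Sum>j\<in>{0..<d}. (if k = j then 1 else 0) * H $$ (j, m))"
      using that assms(1,5) \<pi>k permutes_inj[OF assms(4)] by (simp add: scalar_prod_def inj_eq)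
    also have "\<dots> = (\<Sum>j\<in>{0..<d}. if j = k then H $$ (k, m) else 0)"
      by (intro sum.cong) auto
    finally show ?thesis using assms(7) by simp
  qed
  have "H $$ (\<pi> k, l) = (P * H * D) $$ (\<pi> k, l)"
    using assms(6) by simp
  also have "\<dots> = (\<Sum>m\<in>{0..<d}. (P * H) $$ (\<pi> k, m) * D $$ (m, l))"
    using assms(1,2,5,8) \<pi>k by (simp add: scalar_prod_def)
  also have "\<dots> = (\<Sum>m\<in>{0..<d}. if m = l then H $$ (k, l) * D $$ (l, l) else 0)"
    using assms(2,3,8) by (intro sum.cong) (auto simp: PH diagonal_mat_def)
  finally show ?thesis
    using assms(8) by simp
qed

text \<open>Collects the factors picked up along the edges at \<open>a\<close> into one product over
  the neighbours of \<open>a\<close>; each neighbour occurs once, whether it is smaller or larger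
  than \<open>a\<close>.\<close>

lemma prod_edges_at_vertex:
  fixes f :: "nat \<Rightarrow> 'a::comm_monoid_mult"
  assumes "pair_graph G" "a \<in> {1..n}"
  shows "(\<Prod>(i, j)\<in>{(i, j). i \<in> {1..n} \<and> j \<in> {1..n} \<and> i < j \<and> (i, j) \<in> parcs G}.
      if i = a then f j else if j = a then f i else 1) = (\<Prod>b\<in>{b \<in> {1..n}. (a, b) \<in> parcs G}. f b)"
    (is "prod ?g ?E = prod f ?N")
proof -
  interpret pair_graph G by fact
  have sym: "(j, i) \<in> parcs G" if "(i, j) \<in> parcs G" for i j
    using that arcs_symmetric by blast
  have loop: "(i, i) \<notin> parcs G" for i
    using no_loops[of "(i, i)"] by auto
  have "prod ?g ?E = prod ?g {(i, j) \<in> ?E. i = a \<or> j = a}"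
    by (rule prod.mono_neutral_right)
       (auto intro: finite_subset[of _ "{1..n} \<times> {1..n}"] split: if_splits)
  also have "\<dots> = prod f ?N"
    \<comment> \<open>A neighbour \<open>b\<close> corresponds to the increasing pair formed by
      \<open>a\<close> and \<open>b\<close>; the absence of loops makes that pair strictly
      increasing.\<close>
    by (rule prod.reindex_bij_witness[where i = "\<lambda>b. (min a b, max a b)"
          and j = "\<lambda>(i, j). if i = a then j else i"])
       (use assms(2) sym loop in \<open>auto simp: min_def max_def le_less\<close>)
  finally show ?thesis .
qed

section \<open>Stabilization of the graph state\<close>

theorem proposition17:
  fixes d n a :: nat
    and G :: "nat pair_pre_digraph"
    and H P D :: "complex mat"
  assumes "pair_graph G" and "pverts G = {1..n}"
    and "symmetric_hadamard_mat d H"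
    and "\<forall>j<d. H $$ (0, j) = 1" and "\<forall>i<d. H $$ (i, 0) = 1"
    and "S_symmetry d H P D"
    and "a \<in> pverts G"
  shows "(on_qudit d n P a * neighbour_product d n G D a) *\<^sub>v graph_state d n G H =
         graph_state d n G H"
\<comment> \<open>The vertex \<open>a\<close> forces \<open>1 \<le> n\<close>, so
  \<open>d = 0\<close> gives \<open>d ^ n = 0\<close> and both sides are empty vectors.\<close>
proof (cases "d = 0")
  case True
  have "dim_vec (graph_state d n G H) = 0" "dim_row (on_qudit d n P a) = 0"
    using True assms(2,7)
    by (auto simp: graph_state_def graph_state_op_def edge_product_dim_row on_qudit_def)
  then show ?thesis
    by (intro eq_vecI) simp_all
next
  case False
  then have d: "0 < d" by simp
  have a: "a \<in> {1..n}" using assms(2,7) by simp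
  have H: "H \<in> carrier_mat d d" and HT: "transpose_mat H = H"
    using assms(3) by (auto simp: symmetric_hadamard_mat_def hadamard_mat_def)
  have Hsym: "H $$ (i, j) = H $$ (j, i)" if "i < d" "j < d" for i j
    using that H arg_cong[OF HT, of "\<lambda>M. M $$ (i, j)"] by simp
  obtain \<pi> where \<pi>: "\<pi> permutes {..<d}" and P: "P = mat d d (\<lambda>(i, j). if i = \<pi> j then 1 else 0)"
    using assms(6) by (auto simp: S_symmetry_def permutation_mat_def)
  have D: "D \<in> carrier_mat d d" "diagonal_mat D" and PHD: "P * H * D = H"
    using assms(6) by (auto simp: S_symmetry_def diagonal_unitary_mat_def)
  note HD = S_symmetry_entries[OF H D \<pi> P PHD]
  define q where "q = qudit_val d n"
  define E where "E = {(i, j). i \<in> {1..n} \<and> j \<in> {1..n} \<and> i < j \<and> (i, j) \<in> parcs G}"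
  define N where "N = {b \<in> {1..n}. (a, b) \<in> parcs G}"
  define c where "c = complex_of_real (1 / real d powr (real n / 2))"
  define amp where "amp x = c * (\<Prod>(i, j)\<in>E. H $$ (q x i, q x j))" for x
  define w where "w = vec (d ^ n) (\<lambda>x. (\<Prod>b\<in>N. D $$ (q x b, q x b)) * amp x)"
  have psi: "graph_state d n G H = vec (d ^ n) amp"
    using graph_state_amplitude[OF d assms(5)] by (simp add: amp_def[abs_def] c_def E_def q_def)
  have NP: "neighbour_product d n G D a = diag_of (d ^ n) (\<lambda>x. \<Prod>b\<in>N. D $$ (q x b, q x b))"
    using neighbour_product_diag[OF d D] by (simp add: N_def q_def)
  have "(on_qudit d n P a * neighbour_product d n G D a) *\<^sub>v graph_state d n G H
      = on_qudit d n P a *\<^sub>v (neighbour_product d n G D a *\<^sub>v graph_state d n G H)"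
    by (rule assoc_mult_mat_vec[of _ "d ^ n" "d ^ n" _ "d ^ n"])
       (simp_all add: on_qudit_def NP diag_of_def psi)
  also have "neighbour_product d n G D a *\<^sub>v graph_state d n G H = w"
    unfolding NP psi by (subst diag_of_mult_vec) (auto simp: w_def)
  also have "on_qudit d n P a *\<^sub>v w = graph_state d n G H"
  proof (rule eq_vecI)
    fix x assume "x < dim_vec (graph_state d n G H)"
    then have x: "x < d ^ n" by (simp add: psi)
    have q: "q y i < d" for y i
      unfolding q_def by (rule qudit_val_less[OF d])
    \<comment> \<open>\<open>k\<close> is the preimage of the value of qudit \<open>a\<close> under
      \<pi>; \<open>y\<close> is then \<open>x\<close> with that value replaced by
      \<open>k\<close>.\<close>
    have "q x a \<in> \<pi> ` {..<d}"
      using permutes_image[OF \<pi>] q by simp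
    then obtain k where k: "k < d" "q x a = \<pi> k" by auto
    have "(if i = a then k else q x i) < d" for i
      using k q by simp
    then obtain y where y: "y < d ^ n"
      and qy: "\<And>i. i \<in> {1..n} \<Longrightarrow> q y i = (if i = a then k else q x i)"
      using qudit_val_surj[OF d, of n "\<lambda>i. if i = a then k else q x i"]
      unfolding q_def by blast
    have ya: "q x a = \<pi> (q y a)"
      using qy[OF a] k by simp
    have yi: "q x i = q y i" if "i \<in> {1..n}" "i \<noteq> a" for i
      using qy that by simp
    \<comment> \<open>Passing from \<open>y\<close> to \<open>x\<close> costs a factor of
      \<open>D\<close> at the other endpoint of each edge at \<open>a\<close>, and nothing
      elsewhere.\<close>
    have edge: "H $$ (q x i, q x j) = H $$ (q y i, q y j) *
        (if i = a then D $$ (q y j, q y j) else if j = a then D $$ (q y i, q y i) else 1)"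
      if "(i, j) \<in> E" for i j
    proof -
      from that have ij: "i \<in> {1..n}" "j \<in> {1..n}" "i \<noteq> j" by (auto simp: E_def)
      consider "i = a" | "j = a" | "i \<noteq> a" "j \<noteq> a" by blast
      then show ?thesis
      proof cases
        case 1
        then show ?thesis using ij HD[OF q q] ya yi by simp
      next
        case 2
        \<comment> \<open>\<open>HD\<close> moves \<pi> only in the row index, so symmetry of
          \<open>H\<close> first brings qudit \<open>a\<close> there and afterwards back to the
          column.\<close>
        have "H $$ (q x i, q x j) = H $$ (\<pi> (q y a), q y i)"
          using Hsym[OF q q, of x i x a] 2 ij ya yi by simp
        also have "\<dots> = H $$ (q y i, q y a) * D $$ (q y i, q y i)"
          using HD[OF q q, of y a y i] Hsym[OF q q, of y a y i] by simp
        finally show ?thesis using 2 ij by simp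
      next
        case 3
        then show ?thesis using ij yi by simp
      qed
    qed
    have "(\<Prod>(i, j)\<in>E. H $$ (q x i, q x j)) = (\<Prod>(i, j)\<in>E. H $$ (q y i, q y j)) *
        (\<Prod>(i, j)\<in>E. if i = a then D $$ (q y j, q y j)
          else if j = a then D $$ (q y i, q y i) else 1)"
      unfolding prod.distrib[symmetric] by (intro prod.cong) (auto simp only: edge split: prod.split)
    also have "(\<Prod>(i, j)\<in>E. if i = a then D $$ (q y j, q y j)
        else if j = a then D $$ (q y i, q y i) else 1) = (\<Prod>b\<in>N. D $$ (q y b, q y b))"
      unfolding E_def N_def
      by (rule prod_edges_at_vertex[OF assms(1) a, of "\<lambda>b. D $$ (q y b, q y b)"])
    finally have "amp x = w $ y"
      using y by (simp add: amp_def w_def)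
    \<comment> \<open>\<open>P\<close> on qudit \<open>a\<close> carries the amplitude at
      \<open>y\<close> to \<open>x\<close>, since \<open>x\<close> arises from \<open>y\<close> by
      applying \<pi> at \<open>a\<close>.\<close>
    also have "w $ y = (on_qudit d n P a *\<^sub>v w) $ x"
      using ya yi by (intro on_qudit_permutation_mult_vec[OF d \<pi> P a _ y x, symmetric])
        (auto simp: w_def q_def)
    finally show "(on_qudit d n P a *\<^sub>v w) $ x = graph_state d n G H $ x"
      using x by (simp add: psi)
  qed (simp add: on_qudit_def psi)
  finally show ?thesis .
qed

end
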